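(* The set $\{C_\alpha : \alpha\vDash n\}$ of canonical quasisymmetric functions forms a $\mathbb{Z}$-basis for $\mathrm{QSym}^n$, i.e. for the $\mathbb{Z}$-span of the fundamental quasisymmetric functions $\{F_\alpha:\alpha\vDash n\}$.
   Context: A composition $\alpha=(\alpha_1,\ldots,\alpha_k)$ of $n$ ($\alpha\vDash n$) is an ordered list of positive integers summing to $n$. For $S=\{i_1<\cdots<i_k\}\subseteq[n-1]$ let $\mathrm{comp}(S)=(i_1,i_2-i_1,\ldots,n-i_k)$, and for $\alpha\vDash n$ let $\mathrm{set}(\alpha)=\{\alpha_1,\alpha_1+\alpha_2,\ldots,\alpha_1+\cdots+\alpha_{k-1}\}$. The fundamental quasisymmetric function is $F_\alpha=\sum x_{i_1}\cdots x_{i_n}$ over $1\leq i_1\leq\cdots\leq i_n$ with $i_j<i_{j+1}$ if $j\in\mathrm{set}(\alpha)$ (commuting variables $x_1,x_2,\ldots$). $\mathrm{QSym}^n$ is the span of $\{F_\alpha:\alpha\vDash n\}$. The reverse composition diagram of $\alpha$ is the array of left-justified cells with $\alpha_i$ cells in row $i$ from the top; $(i,j)$ is the cell in row $i$, column $j$. A standard reverse composition tableau (SRCT) of shape $\alpha\vDash n$ is a bijective filling $\tau:\alpha\to\{1,\ldots,n\}$ such that (1) rows decrease from left to right; (2) the first column increases from top to bottom; (3) (triple rule) if $i<j$ and $\tau(i,k)>\tau(j,k+1)$, then $\tau(i,k+1)$ exists and $\tau(i,k+1)>\tau(j,k+1)$. $\mathrm{Des}(\tau)=\{i\in[n-1]: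 i+1\text{ appears weakly right of } i\}$ and $\mathrm{comp}(\tau)=\mathrm{comp}(\mathrm{Des}(\tau))$. The canonical quasisymmetric function is $C_\alpha=\sum_\tau F_{\mathrm{comp}(\tau)}$, summed over all SRCTs $\tau$ of shape $\alpha$ whose entries in each column increase from top to bottom. *)

theory Defs
  imports
    Complex_Main
    "HOL-Library.Multiset"
    "HOL-Library.FuncSet"
    "HOL-Library.Function_Algebras"
begin

definition compositions :: "nat \<Rightarrow> nat list set" where
  "compositions n = {\<alpha>. (\<forall>a \<in> set \<alpha>. 1 \<le> a) \<and> sum_list \<alpha> = n}"

definition comp_set :: "nat list \<Rightarrow> nat set" where
  "comp_set \<alpha> = {sum_list (take i \<alpha>) | i. 1 \<le> i \<and> i < length \<alpha>}"

text \<open>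
  The differences of consecutive entries of \<open>0, i\<^sub>1, \<dots>, i\<^sub>k, n\<close>. The ambient \<open>n\<close> is an argument because
  it cannot be recovered from \<open>S\<close>. For \<open>n = 0\<close> and \<open>S = {}\<close> the result is \<open>[0]\<close>, not the empty
  composition; both index the same fundamental quasisymmetric function, namely the constant series 1.
\<close>

definition comp_of_set :: "nat \<Rightarrow> nat set \<Rightarrow> nat list" where
  "comp_of_set n S = (let xs = sorted_list_of_set S in map2 (-) (xs @ [n]) (0 # xs))"

text \<open>
  A formal power series with integer coefficients in the commuting variables \<open>x\<^sub>1, x\<^sub>2, \<dots>\<close> is
  represented by its coefficient function on monomials. The monomial with factors
  \<open>x\<^bsub>i\<^esub>\<close> is the multiset of their indices, counted with exponent. The index 0 does not name a
  variable, and all series below vanish on multisets containing it.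
\<close>

type_synonym series = "nat multiset \<Rightarrow> int"

definition series_scale :: "int \<Rightarrow> series \<Rightarrow> series" where
  "series_scale c f = (\<lambda>M. c * f M)"

interpretation series: module series_scale
  by unfold_locales (auto simp: series_scale_def algebra_simps)

text \<open>
  The coefficient at a monomial \<open>M\<close> counts the index sequences \<open>i\<^sub>1 \<le> \<dots> \<le> i\<^sub>n\<close> admitted in the
  defining sum whose product is \<open>M\<close>. Lists are indexed from 0, so \<open>i\<^sub>j\<close> is the entry at
  position \<open>j - 1\<close>.
\<close>

definition fundamental :: "nat list \<Rightarrow> series" where
  "fundamental \<alpha> = (\<lambda>M. int (card {xs. length xs = sum_list \<alpha> \<and> (\<forall>x \<in> set xs. 1 \<le> x) \<and> sorted xs \<and>
     (\<forall>j \<in> comp_set \<alpha>. xs ! (j - 1) < xs ! j) \<and> mset xs = M}))"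

definition QSym :: "nat \<Rightarrow> series set" where
  "QSym n = series.span (fundamental ` compositions n)"

definition diagram :: "nat list \<Rightarrow> (nat \<times> nat) set" where
  "diagram \<alpha> = {(i, j). 1 \<le> i \<and> i \<le> length \<alpha> \<and> 1 \<le> j \<and> j \<le> \<alpha> ! (i - 1)}"

text \<open>
  Fillings are extensional, that is, they take a fixed default value outside the diagram, so that
  distinct functions are distinct tableaux.
\<close>

definition SRCT :: "nat list \<Rightarrow> (nat \<times> nat \<Rightarrow> nat) set" where
  "SRCT \<alpha> = {\<tau>. \<tau> \<in> extensional (diagram \<alpha>) \<and> bij_betw \<tau> (diagram \<alpha>) {1..sum_list \<alpha>} \<and>
     (\<forall>i j j'. (i, j) \<in> diagram \<alpha> \<and> (i, j') \<in> diagram \<alpha> \<and> j < j' \<longrightarrow> \<tau> (i, j) > \<tau> (i, j')) \<and>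
     (\<forall>i i'. (i, 1) \<in> diagram \<alpha> \<and> (i', 1) \<in> diagram \<alpha> \<and> i < i' \<longrightarrow> \<tau> (i, 1) < \<tau> (i', 1)) \<and>
     (\<forall>i j k. i < j \<and> (i, k) \<in> diagram \<alpha> \<and> (j, k + 1) \<in> diagram \<alpha> \<and> \<tau> (i, k) > \<tau> (j, k + 1) \<longrightarrow>
        (i, k + 1) \<in> diagram \<alpha> \<and> \<tau> (i, k + 1) > \<tau> (j, k + 1))}"

definition Des :: "nat list \<Rightarrow> (nat \<times> nat \<Rightarrow> nat) \<Rightarrow> nat set" where
  "Des \<alpha> \<tau> = {m \<in> {1..<sum_list \<alpha>}.
     \<exists>c \<in> diagram \<alpha>. \<exists>d \<in> diagram \<alpha>. \<tau> c = m \<and> \<tau> d = m + 1 \<and> snd c \<le> snd d}"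

definition comp_tab :: "nat list \<Rightarrow> (nat \<times> nat \<Rightarrow> nat) \<Rightarrow> nat list" where
  "comp_tab \<alpha> \<tau> = comp_of_set (sum_list \<alpha>) (Des \<alpha> \<tau>)"

definition column_increasing :: "nat list \<Rightarrow> (nat \<times> nat \<Rightarrow> nat) \<Rightarrow> bool" where
  "column_increasing \<alpha> \<tau> \<longleftrightarrow>
     (\<forall>i i' k. (i, k) \<in> diagram \<alpha> \<and> (i', k) \<in> diagram \<alpha> \<and> i < i' \<longrightarrow> \<tau> (i, k) < \<tau> (i', k))"

definition canonical :: "nat list \<Rightarrow> series" where
  "canonical \<alpha> = (\<Sum>\<tau> \<in> {\<tau> \<in> SRCT \<alpha>. column_increasing \<alpha> \<tau>}. fundamental (comp_tab \<alpha> \<tau>))"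

end

theory Submission
  imports Defs
begin

text \<open>
  Cut the values \<open>1, \<dots>, n\<close> of a tableau \<open>\<tau>\<close> of shape \<open>\<alpha>\<close> into blocks at its descents. Within a block
  the values move strictly left, so a block of size \<open>b\<close> occupies \<open>b\<close> distinct columns, whose indices
  sum to at least \<open>1 + \<dots> + b\<close>. Hence the weight of a composition, the sum of the column indices of
  the cells of its diagram, is at least as large for \<open>\<alpha>\<close> as for \<open>\<beta> = comp(\<tau>)\<close>. In the case of
  equality every block fills columns \<open>b, \<dots>, 1\<close> in this order; the triple rule and the increasing
  columns then force every block to be a row, so \<open>\<tau>\<close> is the tableau filled row by row and
  \<open>\<beta> = \<alpha>\<close>. The transition matrix from the fundamental to the canonical functions is therefore
  unitriangular with respect to the weight. The fundamental functions are independent since the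
  monomial \<open>x\<^sup>\<beta>\<close> occurs in \<open>F\<^sub>\<alpha>\<close> if and only if \<open>set(\<alpha>) \<subseteq> set(\<beta>)\<close>.
\<close>

section \<open>Linear algebra over a ring: finite families and unitriangular changes of
  basis\<close>

context module
begin

text \<open>Coefficients are attached to indices instead of vectors, as in the relations
  \<open>indep\<close> below. Splitting off one generator at a time avoids choosing representatives
  where \<open>f\<close> repeats a value.\<close>

lemma in_span_image_finite:
  assumes "finite J" and "x \<in> span (f ` J)"
  shows "\<exists>a. x = (\<Sum>j\<in>J. a j *s f j)"
  using assms
proof (induction J arbitrary: x rule: finite_induct)
  case empty
  then show ?case by simp
next
  case (insert i J)
  from insert.prems obtain k where "x - k *s f i \<in> span (f ` J)"
    by (auto simp: span_breakdown_eq)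
  with insert.IH obtain a where a: "x - k *s f i = (\<Sum>j\<in>J. a j *s f j)"
    by blast
  have "(\<Sum>j\<in>J. (a(i := k)) j *s f j) = (\<Sum>j\<in>J. a j *s f j)"
    using insert.hyps by (intro sum.cong) auto
  with a have "x = (\<Sum>j\<in>insert i J. (a(i := k)) j *s f j)"
    using insert.hyps by (simp add: algebra_simps)
  then show ?case by blast
qed

text \<open>\<open>independent\<close> speaks of a set of vectors and cannot see repetitions, so
  injectivity is a separate conclusion. A repetition \<open>g i = g j\<close> would give the
  relation with coefficient 1 at \<open>i\<close> and -1 at \<open>j\<close>.\<close>

lemma independent_family_image:
  assumes "finite I"
    and indep: "\<And>c. (\<Sum>i\<in>I. c i *s g i) = 0 \<Longrightarrow> \<forall>i\<in>I. c i = 0"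
  shows "inj_on g I" and "independent (g ` I)"
proof -
  show inj: "inj_on g I"
  proof (rule inj_onI, rule ccontr)
    fix i j assume ij: "i \<in> I" "j \<in> I" "g i = g j" "i \<noteq> j"
    define c :: "_ \<Rightarrow> 'a" where "c k = (if k = i then 1 else if k = j then - 1 else 0)" for k
    have "(\<Sum>k\<in>I. c k *s g k) = (\<Sum>k\<in>{i, j}. c k *s g k)"
      using ij \<open>finite I\<close> by (intro sum.mono_neutral_right) (auto simp: c_def)
    also have "\<dots> = 0" using ij by (simp add: c_def)
    finally have "c i = 0" using indep ij(1) by blast
    then show False by (simp add: c_def)
  qed
  show "independent (g ` I)"
  proof
    assume "dependent (g ` I)"
    then obtain u where "\<exists>i\<in>I. u (g i) \<noteq> 0" "(\<Sum>x\<in>g ` I. u x *s x) = 0"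
      using \<open>finite I\<close> by (auto simp: dependent_finite)
    with indep[of "\<lambda>i. u (g i)"] show False
      by (auto simp: sum.reindex[OF inj])
  qed
qed

text \<open>Over a ring, a multiple of \<open>f i\<close> can lie in a span that does not contain
  \<open>f i\<close>. Working with \<open>k *s f i\<close> takes the place of dividing by
  \<open>k\<close>.\<close>

lemma independent_family_scale_in_span:
  assumes "finite I" "i \<in> I"
    and indep: "\<And>c. (\<Sum>i\<in>I. c i *s f i) = 0 \<Longrightarrow> \<forall>i\<in>I. c i = 0"
    and span: "k *s f i \<in> span (f ` (I - {i}))"
  shows "k = 0"
proof -
  obtain a where a: "k *s f i = (\<Sum>j\<in>I - {i}. a j *s f j)"
    using in_span_image_finite[OF _ span] \<open>finite I\<close> by auto
  let ?c = "a(i := - k)"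
  have "(\<Sum>j\<in>I. ?c j *s f j) = - (k *s f i) + (\<Sum>j\<in>I - {i}. ?c j *s f j)"
    using \<open>finite I\<close> \<open>i \<in> I\<close> by (simp add: sum.remove)
  also have "(\<Sum>j\<in>I - {i}. ?c j *s f j) = (\<Sum>j\<in>I - {i}. a j *s f j)"
    by (intro sum.cong) auto
  finally have "(\<Sum>j\<in>I. ?c j *s f j) = 0" using a by simp
  from indep[OF this] \<open>i \<in> I\<close> show ?thesis by auto
qed

text \<open>A relation among the \<open>g i\<close> is read off at an index of maximal weight with
  nonzero coefficient: modulo the other \<open>f j\<close> only \<open>c i *s f i\<close> remains.
  The expansion is inverted by induction on the weight; as the diagonal is 1, no division
  occurs.\<close>

lemma unitriangular_basis:
  fixes w :: "'i \<Rightarrow> nat"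
  assumes fin: "finite I"
    and indep: "\<And>c. (\<Sum>i\<in>I. c i *s f i) = 0 \<Longrightarrow> \<forall>i\<in>I. c i = 0"
    and tri: "\<And>i. i \<in> I \<Longrightarrow> g i - f i \<in> span (f ` {j \<in> I. w j < w i})"
  shows "inj_on g I" and "independent (g ` I)" and "span (g ` I) = span (f ` I)"
proof -
  have "\<forall>i\<in>I. c i = 0" if c: "(\<Sum>i\<in>I. c i *s g i) = 0" for c
  proof (rule ccontr)
    assume "\<not> (\<forall>i\<in>I. c i = 0)"
    then have "finite (w ` {i \<in> I. c i \<noteq> 0})" "w ` {i \<in> I. c i \<noteq> 0} \<noteq> {}" using fin by auto
    from Max_in[OF this] Max_ge[OF this(1)]
    obtain i where i: "i \<in> I" "c i \<noteq> 0"
      and max: "\<And>j. j \<in> I \<Longrightarrow> c j \<noteq> 0 \<Longrightarrow> w j \<le> w i" by auto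
    \<comment> \<open>All indices except \<open>i\<close> are allowed, so that those tied with
      \<open>i\<close> in weight are absorbed as well.\<close>
    let ?S = "span (f ` (I - {i}))"
    have low: "g j - f j \<in> ?S" if "j \<in> I" "w j \<le> w i" for j
    proof -
      have "f ` {k \<in> I. w k < w j} \<subseteq> f ` (I - {i})" using that by auto
      from span_mono[OF this] tri[OF that(1)] show ?thesis by blast
    qed
    have "c j *s g j \<in> ?S" if "j \<in> I - {i}" for j
    proof (cases "c j = 0")
      case False
      then have "g j - f j + f j \<in> ?S"
        using that low max by (intro span_add span_base[of "f j"]) auto
      then show ?thesis by (simp add: span_scale)
    qed (simp add: span_zero)
    then have "(\<Sum>j\<in>I - {i}. c j *s g j) \<in> ?S" by (rule span_sum)
    moreover have "c i *s (g i - f i) \<in> ?S" using low i by (intro span_scale) auto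
    moreover have "c i *s f i = - (\<Sum>j\<in>I - {i}. c j *s g j) - c i *s (g i - f i)"
      using c fin i by (simp add: sum.remove algebra_simps add_eq_0_iff)
    ultimately have "c i *s f i \<in> ?S" by (auto intro: span_diff span_neg)
    with independent_family_scale_in_span[OF fin i(1) indep] i(2) show False by blast
  qed
  then show "inj_on g I" "independent (g ` I)"
    using independent_family_image[OF fin] by blast+
  have f: "f i \<in> span (g ` I)" if "i \<in> I" for i
    using that
  proof (induction "w i" arbitrary: i rule: less_induct)
    case less
    then have "f ` {j \<in> I. w j < w i} \<subseteq> span (g ` I)" by auto
    from span_mono[OF this] tri[OF less.prems] have "g i - f i \<in> span (g ` I)"
      by (auto simp: span_span)
    moreover have "g i \<in> span (g ` I)" using less.prems by (intro span_base) simp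
    ultimately have "g i - (g i - f i) \<in> span (g ` I)" by (metis span_diff)
    then show ?case by simp
  qed
  have g: "g i \<in> span (f ` I)" if "i \<in> I" for i
  proof -
    have "g i - f i \<in> span (f ` I)"
      using tri[OF that] span_mono[of "f ` {j \<in> I. w j < w i}" "f ` I"] by blast
    then have "g i - f i + f i \<in> span (f ` I)"
      using that by (intro span_add span_base[of "f i"]) auto
    then show ?thesis by simp
  qed
  show "span (g ` I) = span (f ` I)"
    unfolding span_eq using f g by auto
qed

end


subsection \<open>Compositions and subsets\<close>

lemma sum_list_take_mono: "i \<le> j \<Longrightarrow> sum_list (take i \<alpha>) \<le> sum_list (take j (\<alpha> :: nat list))"
  by (metis le_Suc_ex le_add1 sum_list_append take_add)

lemma sum_list_take_Suc:
  "i < length \<alpha> \<Longrightarrow> sum_list (take (Suc i) \<alpha>) = sum_list (take i \<alpha>) + (\<alpha> ! i :: nat)"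
  by (simp add: take_Suc_conv_app_nth)

lemma sum_list_take_strict_mono:
  assumes "\<alpha> \<in> compositions n" "i < j" "j \<le> length \<alpha>"
  shows "sum_list (take i \<alpha>) < sum_list (take j \<alpha>)"
proof -
  have "\<alpha> ! i \<ge> 1" using assms by (auto simp: compositions_def)
  then have "sum_list (take i \<alpha>) < sum_list (take (Suc i) \<alpha>)"
    using assms by (simp add: sum_list_take_Suc)
  also have "\<dots> \<le> sum_list (take j \<alpha>)" using assms by (intro sum_list_take_mono) simp
  finally show ?thesis .
qed

lemma comp_set_subset:
  assumes "\<alpha> \<in> compositions n"
  shows "comp_set \<alpha> \<subseteq> {1..<n}"
proof -
  have "0 < sum_list (take i \<alpha>) \<and> sum_list (take i \<alpha>) < n" if "1 \<le> i" "i < length \<alpha>" for i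
    using sum_list_take_strict_mono[OF assms, of 0 i]
      sum_list_take_strict_mono[OF assms, of i "length \<alpha>"] that assms
    by (auto simp: compositions_def)
  then show ?thesis unfolding comp_set_def by fastforce
qed

text \<open>Positive parts make the partial sums strictly increasing, so sorting the set recovers
  them in order and hence, by differences, the composition.\<close>

lemma sorted_list_of_comp_set:
  assumes "\<alpha> \<in> compositions n"
  shows "sorted_list_of_set (comp_set \<alpha>) = map (\<lambda>i. sum_list (take i \<alpha>)) [1..<length \<alpha>]"
proof (rule strict_sorted_equal)
  show "sorted_wrt (<) (map (\<lambda>i. sum_list (take i \<alpha>)) [1..<length \<alpha>])"
    using sum_list_take_strict_mono[OF assms]
    by (auto simp: sorted_wrt_map sorted_wrt_iff_nth_less)
  have "finite (comp_set \<alpha>)"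
    using comp_set_subset[OF assms] finite_subset by blast
  then show "set (sorted_list_of_set (comp_set \<alpha>)) =
      set (map (\<lambda>i. sum_list (take i \<alpha>)) [1..<length \<alpha>])"
    by (auto simp: comp_set_def)
qed simp

lemma inj_on_comp_set: "inj_on comp_set (compositions n)"
proof (rule inj_onI)
  fix \<alpha> \<beta> assume \<alpha>: "\<alpha> \<in> compositions n" and \<beta>: "\<beta> \<in> compositions n"
    and eq: "comp_set \<alpha> = comp_set \<beta>"
  have sum: "sum_list \<alpha> = n" "sum_list \<beta> = n" using \<alpha> \<beta> by (auto simp: compositions_def)
  have maps: "map (\<lambda>i. sum_list (take i \<alpha>)) [1..<length \<alpha>] =
      map (\<lambda>i. sum_list (take i \<beta>)) [1..<length \<beta>]"
    using sorted_list_of_comp_set[OF \<alpha>] sorted_list_of_comp_set[OF \<beta>] eq by simp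
  \<comment> \<open>\<open>maps\<close> gives the lengths only up to \<open>length - 1\<close>,
    which does not separate the empty list from a list with one part. For \<open>n = 0\<close> both
    compositions are empty, otherwise neither is.\<close>
  show "\<alpha> = \<beta>"
  proof (cases "n = 0")
    case True
    have "\<gamma> = []" if "\<gamma> \<in> compositions n" for \<gamma>
      using that True by (cases \<gamma>) (auto simp: compositions_def)
    from this[OF \<alpha>] this[OF \<beta>] show ?thesis by simp
  next
    case False
    then have "\<alpha> \<noteq> []" "\<beta> \<noteq> []" using sum by (metis sum_list.Nil)+
    moreover have "length \<alpha> - 1 = length \<beta> - 1"
      using arg_cong[OF maps, of length] by simp
    ultimately have len: "length \<alpha> = length \<beta>"
      by (cases \<alpha>; cases \<beta>) auto
    have ps: "sum_list (take i \<alpha>) = sum_list (take i \<beta>)" for i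
    proof -
      consider "i = 0" | "length \<alpha> \<le> i" | "i \<in> set [1..<length \<alpha>]" by fastforce
      then show ?thesis
      proof cases
        case 3
        then show ?thesis using maps unfolding len map_eq_conv by blast
      qed (use sum len in auto)
    qed
    show ?thesis
    proof (rule nth_equalityI[OF len])
      fix i assume "i < length \<alpha>"
      then show "\<alpha> ! i = \<beta> ! i"
        using ps[of i] ps[of "Suc i"] len by (simp add: sum_list_take_Suc)
    qed
  qed
qed

lemma finite_compositions: "finite (compositions n)"
proof (rule inj_on_finite[OF inj_on_comp_set])
  show "comp_set ` compositions n \<subseteq> Pow {1..<n}" using comp_set_subset by blast
qed simp

lemma comp_of_set:
  assumes "S \<subseteq> {1..<n}"
  shows "sum_list (comp_of_set n S) = n" and "comp_set (comp_of_set n S) = S"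
    and "n > 0 \<Longrightarrow> comp_of_set n S \<in> compositions n"
proof -
  define xs where "xs = sorted_list_of_set S"
  \<comment> \<open>With 0 and \<open>n\<close> added at the ends, the parts are consecutive
    differences and their partial sums telescope to the entries of \<open>ys\<close>.\<close>
  define ys where "ys = 0 # xs @ [n]"
  have fin: "finite S" using assms finite_subset by blast
  have set: "set xs = S" using fin by (simp add: xs_def)
  have "sorted_wrt (<) (xs @ [n])"
    using assms set by (auto simp: sorted_wrt_append xs_def)
  \<comment> \<open>The exception is \<open>n = 0\<close>, where \<open>ys\<close> is
    \<open>[0, 0]\<close>.\<close>
  then have strict: "xs @ [n] = [0] \<or> sorted_wrt (<) ys"
    using assms set by (cases xs) (auto simp: ys_def)
  have mono: "ys ! i \<le> ys ! Suc i" if "i < Suc (length xs)" for i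
    using strict that sorted_wrt_nth_less[of "(<)" ys i "Suc i"] by (auto simp: ys_def)
  let ?c = "comp_of_set n S"
  have len: "length ?c = Suc (length xs)" by (simp add: comp_of_set_def xs_def Let_def)
  have nth: "?c ! i = ys ! Suc i - ys ! i" if "i < Suc (length xs)" for i
  proof -
    have "(0 # xs) ! i = ys ! i"
      using that by (cases i) (auto simp: ys_def nth_append)
    then show ?thesis
      using that by (simp add: comp_of_set_def xs_def[symmetric] Let_def ys_def)
  qed
  have ps: "sum_list (take i ?c) = ys ! i" if "i \<le> Suc (length xs)" for i
    using that
  proof (induction i)
    case (Suc i)
    then show ?case using mono[of i] nth[of i] len by (simp add: sum_list_take_Suc)
  qed (simp add: ys_def)
  from ps[of "Suc (length xs)"] len show sum: "sum_list ?c = n"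
    by (simp add: ys_def)
  show "comp_set ?c = S"
  proof -
    have "comp_set ?c = {ys ! i | i. 1 \<le> i \<and> i < Suc (length xs)}"
      unfolding comp_set_def len by (intro Collect_cong ex_cong1) (auto simp: ps)
    also have "\<dots> = {xs ! i | i. i < length xs}"
    proof (intro set_eqI iffI; clarsimp)
      fix i assume "Suc 0 \<le> i" "i < Suc (length xs)"
      then show "\<exists>k. ys ! i = xs ! k \<and> k < length xs"
        by (cases i) (auto simp: ys_def nth_append)
    next
      fix k assume "k < length xs"
      then show "\<exists>i. xs ! k = ys ! i \<and> Suc 0 \<le> i \<and> i < Suc (length xs)"
        by (intro exI[of _ "Suc k"]) (auto simp: ys_def nth_append)
    qed
    also have "\<dots> = S" using set by (auto simp: set_conv_nth)
    finally show ?thesis .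
  qed
  assume "n > 0"
  then have "sorted_wrt (<) ys" using strict by auto
  then have "1 \<le> ?c ! i" if "i < length ?c" for i
    using that len nth[of i] sorted_wrt_nth_less[of "(<)" ys i "Suc i"] by (auto simp: ys_def)
  then show "?c \<in> compositions n"
    using sum unfolding compositions_def by (auto simp: in_set_conv_nth)
qed

text \<open>For \<open>n = 0\<close>, \<open>comp_of_set\<close> returns \<open>[0]\<close>, which
  is not a composition, so the empty list is the witness there.\<close>

lemma comp_set_surj:
  assumes "S \<subseteq> {1..<n}"
  shows "\<exists>\<beta>\<in>compositions n. comp_set \<beta> = S"
proof (cases "n = 0")
  case True
  then show ?thesis using assms by (intro bexI[of _ "[]"]) (auto simp: compositions_def comp_set_def)
next
  case False
  then show ?thesis using comp_of_set[OF assms] by blast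
qed


subsection \<open>Independence of the fundamental quasisymmetric functions\<close>

text \<open>Lets a genuine composition stand for an output of \<open>comp_of_set\<close>, including
  the output \<open>[0]\<close> at \<open>n = 0\<close>.\<close>

lemma fundamental_cong:
  "sum_list \<alpha> = sum_list \<beta> \<Longrightarrow> comp_set \<alpha> = comp_set \<beta> \<Longrightarrow> fundamental \<alpha> = fundamental \<beta>"
  by (simp add: fundamental_def)

text \<open>
  For \<open>S = set(\<alpha>)\<close> this is the word with \<open>\<alpha>\<^sub>1\<close> ones, \<open>\<alpha>\<^sub>2\<close> twos, and so on; the product of its
  variables is the monomial \<open>x\<^sup>\<alpha>\<close>.
\<close>

definition comp_word :: "nat \<Rightarrow> nat set \<Rightarrow> nat list" where
  "comp_word n S = map (\<lambda>p. Suc (card {s \<in> S. s \<le> p})) [0..<n]"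

text \<open>From position \<open>j - 1\<close> to \<open>j\<close> the count of elements of
  \<open>S\<close> grows exactly when \<open>j\<close> itself is one of them.\<close>

lemma comp_word_ascent:
  assumes "S \<subseteq> {1..<n}" "1 \<le> j" "j < n"
  shows "comp_word n S ! (j - 1) < comp_word n S ! j \<longleftrightarrow> j \<in> S"
proof -
  have fin: "finite S" using assms finite_subset by blast
  show ?thesis
  proof (cases "j \<in> S")
    case True
    moreover from this have "j \<notin> {s \<in> S. s \<le> j - 1}" "j \<in> {s \<in> S. s \<le> j}"
      using assms by auto
    ultimately have "{s \<in> S. s \<le> j - 1} \<subset> {s \<in> S. s \<le> j}" by fastforce
    then have "card {s \<in> S. s \<le> j - 1} < card {s \<in> S. s \<le> j}"
      using fin by (intro psubset_card_mono) auto
    then show ?thesis using True assms by (auto simp: comp_word_def)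
  next
    case False
    then have "s \<le> j - 1 \<longleftrightarrow> s \<le> j" if "s \<in> S" for s using that by (cases "s = j") auto
    then have "{s \<in> S. s \<le> j - 1} = {s \<in> S. s \<le> j}" by blast
    then have "comp_word n S ! (j - 1) = comp_word n S ! j"
      using assms by (simp add: comp_word_def less_imp_diff_less)
    then show ?thesis using False by simp
  qed
qed

lemma fundamental_comp_word:
  assumes "\<beta> \<in> compositions n" "S \<subseteq> {1..<n}"
  shows "fundamental \<beta> (mset (comp_word n S)) = (if comp_set \<beta> \<subseteq> S then 1 else 0)"
proof -
  let ?w = "comp_word n S"
  have fin: "finite S" using assms finite_subset by blast
  have sorted: "sorted ?w"
    by (auto simp: comp_word_def sorted_iff_nth_mono fin intro!: card_mono)
  have asc: "(\<forall>j\<in>comp_set \<beta>. ?w ! (j - 1) < ?w ! j) \<longleftrightarrow> comp_set \<beta> \<subseteq> S"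
    using comp_set_subset[OF assms(1)] comp_word_ascent[OF assms(2)] by (auto simp: subset_iff)
  have "{xs. length xs = sum_list \<beta> \<and> (\<forall>x\<in>set xs. 1 \<le> x) \<and> sorted xs \<and>
      (\<forall>j\<in>comp_set \<beta>. xs ! (j - 1) < xs ! j) \<and> mset xs = mset ?w} =
      (if comp_set \<beta> \<subseteq> S then {?w} else {})" (is "?A = _")
  proof -
    have "length ?w = sum_list \<beta>" "\<forall>x\<in>set ?w. 1 \<le> x"
      using assms(1) by (auto simp: comp_word_def compositions_def)
    moreover have "xs = ?w" if "sorted xs" "mset xs = mset ?w" for xs
      using that sorted by (metis properties_for_sort)
    ultimately have "?A = {xs. xs = ?w \<and> (\<forall>j\<in>comp_set \<beta>. ?w ! (j - 1) < ?w ! j)}"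
      using sorted by blast
    then show ?thesis unfolding asc by auto
  qed
  then show ?thesis by (simp add: fundamental_def)
qed

lemma series_sum_apply: "(\<Sum>i\<in>I. f i) M = (\<Sum>i\<in>I. (f i :: series) M)"
  by (induction I rule: infinite_finite_induct) auto

text \<open>Among the \<alpha> with nonzero coefficient, choose one with
  \<open>comp_set \<alpha>\<close> of least cardinality. At its monomial only those \<beta> with
  \<open>comp_set \<beta> \<subseteq> comp_set \<alpha>\<close> contribute, and minimality leaves
  \<alpha> alone.\<close>

lemma fundamental_independent:
  assumes sum: "(\<Sum>\<alpha>\<in>compositions n. series_scale (c \<alpha>) (fundamental \<alpha>)) = 0"
  shows "\<forall>\<alpha>\<in>compositions n. c \<alpha> = 0"
proof (rule ccontr)
  let ?K = "{\<alpha> \<in> compositions n. c \<alpha> \<noteq> 0}"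
  assume "\<not> ?thesis"
  then have K: "finite ?K" "?K \<noteq> {}" using finite_compositions by auto
  define \<alpha> where "\<alpha> = arg_min_on (\<lambda>\<alpha>. card (comp_set \<alpha>)) ?K"
  have \<alpha>: "\<alpha> \<in> compositions n" "c \<alpha> \<noteq> 0"
    using arg_min_if_finite(1)[OF K, of "\<lambda>\<alpha>. card (comp_set \<alpha>)"] unfolding \<alpha>_def by auto
  have min: "card (comp_set \<alpha>) \<le> card (comp_set \<beta>)" if "\<beta> \<in> ?K" for \<beta>
    using arg_min_if_finite(2)[OF K, of "\<lambda>\<alpha>. card (comp_set \<alpha>)"] that unfolding \<alpha>_def
    by (auto simp: not_less)
  have sub: "comp_set \<alpha> \<subseteq> {1..<n}" by (rule comp_set_subset[OF \<alpha>(1)])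
  have zero: "c \<beta> = 0" if "\<beta> \<in> compositions n" "comp_set \<beta> \<subseteq> comp_set \<alpha>" "\<beta> \<noteq> \<alpha>" for \<beta>
  proof (rule ccontr)
    assume "c \<beta> \<noteq> 0"
    then have "card (comp_set \<alpha>) \<le> card (comp_set \<beta>)" using that min by auto
    then have "comp_set \<beta> = comp_set \<alpha>"
      using that sub by (intro card_seteq) (auto intro: finite_subset)
    with that \<alpha> inj_on_comp_set show False by (auto dest: inj_onD)
  qed
  have "0 = (\<Sum>\<beta>\<in>compositions n. c \<beta> * fundamental \<beta> (mset (comp_word n (comp_set \<alpha>))))"
    using fun_cong[OF sum, of "mset (comp_word n (comp_set \<alpha>))"]
    by (simp add: series_sum_apply series_scale_def)
  also have "\<dots> = (\<Sum>\<beta>\<in>compositions n. if \<beta> = \<alpha> then c \<alpha> else 0)"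
    using zero sub by (intro sum.cong) (auto simp: fundamental_comp_word)
  also have "\<dots> = c \<alpha>" using \<alpha> finite_compositions by simp
  finally show False using \<alpha> by simp
qed


subsection \<open>The canonical tableau\<close>

text \<open>The filling row by row with consecutive values: the largest entry of row
  \<open>i\<close>, in column 1, is the \<open>i\<close>-th partial sum of \<alpha>. The restriction
  makes it extensional, as \<open>SRCT\<close> demands.\<close>

definition canonical_tableau :: "nat list \<Rightarrow> nat \<times> nat \<Rightarrow> nat" where
  "canonical_tableau \<alpha> =
     restrict (\<lambda>(i, j). Suc (sum_list (take i \<alpha>)) - j) (diagram \<alpha>)"

lemma finite_diagram: "finite (diagram \<alpha>)"
proof (rule finite_subset)
  have "\<alpha> ! (i - 1) \<le> sum_list \<alpha>" if "1 \<le> i" "i \<le> length \<alpha>" for i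
    using that by (intro member_le_sum_list nth_mem) auto
  then show "diagram \<alpha> \<subseteq> {1..length \<alpha>} \<times> {1..sum_list \<alpha>}"
    by (fastforce simp: diagram_def)
qed simp

lemma diagram_left: "(i, j) \<in> diagram \<alpha> \<Longrightarrow> 1 \<le> k \<Longrightarrow> k \<le> j \<Longrightarrow> (i, k) \<in> diagram \<alpha>"
  by (auto simp: diagram_def)

lemma diagram_sum_list_take:
  assumes "(i, j) \<in> diagram \<alpha>"
  shows "sum_list (take i \<alpha>) = sum_list (take (i - 1) \<alpha>) + \<alpha> ! (i - 1)"
  using assms sum_list_take_Suc[of "i - 1" \<alpha>] by (auto simp: diagram_def)

text \<open>The first fact is additive to escape truncated subtraction. The bounds put row
  \<open>i\<close> between two consecutive partial sums, so the rows occupy successive disjoint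
  intervals.\<close>

lemma canonical_tableau:
  assumes "(i, j) \<in> diagram \<alpha>"
  shows "canonical_tableau \<alpha> (i, j) + j = Suc (sum_list (take i \<alpha>))"
    and "sum_list (take (i - 1) \<alpha>) < canonical_tableau \<alpha> (i, j)"
    and "canonical_tableau \<alpha> (i, j) \<le> sum_list (take i \<alpha>)"
proof -
  have "1 \<le> j" "j \<le> \<alpha> ! (i - 1)" using assms by (auto simp: diagram_def)
  with assms diagram_sum_list_take[OF assms]
  show "canonical_tableau \<alpha> (i, j) + j = Suc (sum_list (take i \<alpha>))"
    "sum_list (take (i - 1) \<alpha>) < canonical_tableau \<alpha> (i, j)"
    "canonical_tableau \<alpha> (i, j) \<le> sum_list (take i \<alpha>)"
    by (auto simp: canonical_tableau_def)
qed

lemma canonical_tableau_less: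
  assumes "(i, j) \<in> diagram \<alpha>" "(i', j') \<in> diagram \<alpha>" "i < i'"
  shows "canonical_tableau \<alpha> (i, j) < canonical_tableau \<alpha> (i', j')"
  using canonical_tableau(3)[OF assms(1)] canonical_tableau(2)[OF assms(2)]
    sum_list_take_mono[of i "i' - 1" \<alpha>] assms(3) by linarith

lemma canonical_tableau_step:
  assumes "(i, Suc k) \<in> diagram \<alpha>" "1 \<le> k"
  shows "canonical_tableau \<alpha> (i, k) = Suc (canonical_tableau \<alpha> (i, Suc k))"
  using canonical_tableau(1)[OF assms(1)] canonical_tableau(1)[OF diagram_left[OF assms(1), of k]] assms
  by simp

lemma bij_betw_canonical_tableau:
  "bij_betw (canonical_tableau \<alpha>) (diagram \<alpha>) {1..sum_list \<alpha>}"
proof (rule bij_betw_imageI)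
  show "inj_on (canonical_tableau \<alpha>) (diagram \<alpha>)"
  proof (rule inj_onI, clarify)
    fix i j i' j'
    assume ij: "(i, j) \<in> diagram \<alpha>" "(i', j') \<in> diagram \<alpha>"
      and eq: "canonical_tableau \<alpha> (i, j) = canonical_tableau \<alpha> (i', j')"
    then have "i = i'"
      using canonical_tableau_less by (metis less_irrefl linorder_less_linear)
    with eq canonical_tableau(1)[OF ij(1)] canonical_tableau(1)[OF ij(2)] show "i = i' \<and> j = j'"
      by simp
  qed
  show "canonical_tableau \<alpha> ` diagram \<alpha> = {1..sum_list \<alpha>}"
  proof (intro equalityI subsetI)
    fix m assume "m \<in> canonical_tableau \<alpha> ` diagram \<alpha>"
    then obtain i j where "(i, j) \<in> diagram \<alpha>" "m = canonical_tableau \<alpha> (i, j)" by auto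
    with canonical_tableau(2,3)[of i j \<alpha>] sum_list_take_mono[of i "max i (length \<alpha>)" \<alpha>]
    show "m \<in> {1..sum_list \<alpha>}" by simp
  next
    fix m assume m: "m \<in> {1..sum_list \<alpha>}"
    \<comment> \<open>The row holding \<open>m\<close> is the first one whose partial sum reaches
      \<open>m\<close>; minimality yields the lower bound \<open>gt\<close>.\<close>
    define i where "i = (LEAST i. m \<le> sum_list (take i \<alpha>))"
    have len: "m \<le> sum_list (take (length \<alpha>) \<alpha>)" using m by simp
    have le: "m \<le> sum_list (take i \<alpha>)" unfolding i_def using len by (rule LeastI)
    have "i \<le> length \<alpha>" unfolding i_def using len by (rule Least_le)
    moreover have "i \<noteq> 0" using le m by (intro notI) simp
    moreover from this have gt: "sum_list (take (i - 1) \<alpha>) < m"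
      using not_less_Least[of "i - 1" "\<lambda>i. m \<le> sum_list (take i \<alpha>)"] by (simp add: i_def)
    moreover have "sum_list (take i \<alpha>) = sum_list (take (i - 1) \<alpha>) + \<alpha> ! (i - 1)"
      using calculation sum_list_take_Suc[of "i - 1" \<alpha>] by simp
    ultimately have c: "(i, Suc (sum_list (take i \<alpha>)) - m) \<in> diagram \<alpha>"
      using le by (auto simp: diagram_def)
    have "canonical_tableau \<alpha> (i, Suc (sum_list (take i \<alpha>)) - m) = m"
      using canonical_tableau(1)[OF c] le by simp
    with c show "m \<in> canonical_tableau \<alpha> ` diagram \<alpha>" by (metis image_eqI)
  qed
qed

lemma SRCT_D:
  assumes "\<tau> \<in> SRCT \<alpha>"
  shows SRCT_extensional: "\<tau> \<in> extensional (diagram \<alpha>)"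
    and SRCT_bij_betw: "bij_betw \<tau> (diagram \<alpha>) {1..sum_list \<alpha>}"
    and SRCT_row: "(i, j) \<in> diagram \<alpha> \<Longrightarrow> (i, j') \<in> diagram \<alpha> \<Longrightarrow> j < j' \<Longrightarrow> \<tau> (i, j') < \<tau> (i, j)"
    and SRCT_first_column:
      "(i, 1) \<in> diagram \<alpha> \<Longrightarrow> (i', 1) \<in> diagram \<alpha> \<Longrightarrow> i < i' \<Longrightarrow> \<tau> (i, 1) < \<tau> (i', 1)"
    and SRCT_triple: "i < i' \<Longrightarrow> (i, k) \<in> diagram \<alpha> \<Longrightarrow> (i', k + 1) \<in> diagram \<alpha> \<Longrightarrow>
      \<tau> (i', k + 1) < \<tau> (i, k) \<Longrightarrow> (i, k + 1) \<in> diagram \<alpha> \<and> \<tau> (i', k + 1) < \<tau> (i, k + 1)"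
  using assms unfolding SRCT_def mem_Collect_eq by blast+

text \<open>The triple rule holds vacuously, since every entry of a lower row is larger.\<close>

lemma canonical_tableau_SRCT: "canonical_tableau \<alpha> \<in> SRCT \<alpha>"
  unfolding SRCT_def
proof (intro CollectI conjI allI impI; (elim conjE)?)
  show "canonical_tableau \<alpha> \<in> extensional (diagram \<alpha>)"
    by (simp add: canonical_tableau_def)
  show "bij_betw (canonical_tableau \<alpha>) (diagram \<alpha>) {1..sum_list \<alpha>}"
    by (rule bij_betw_canonical_tableau)
next
  fix i j j' assume "(i, j) \<in> diagram \<alpha>" "(i, j') \<in> diagram \<alpha>" "j < j'"
  then show "canonical_tableau \<alpha> (i, j') < canonical_tableau \<alpha> (i, j)"
    using canonical_tableau(1)[of i j \<alpha>] canonical_tableau(1)[of i j' \<alpha>] by simp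
next
  fix i j k
  assume "i < j" "(i, k) \<in> diagram \<alpha>" "(j, k + 1) \<in> diagram \<alpha>"
    "canonical_tableau \<alpha> (j, k + 1) < canonical_tableau \<alpha> (i, k)"
  then have False using canonical_tableau_less[of i k \<alpha> j "k + 1"] by simp
  then show "(i, k + 1) \<in> diagram \<alpha>"
    "canonical_tableau \<alpha> (j, k + 1) < canonical_tableau \<alpha> (i, k + 1)" by blast+
qed (auto intro: canonical_tableau_less)

lemma column_increasing_canonical_tableau: "column_increasing \<alpha> (canonical_tableau \<alpha>)"
  by (auto simp: column_increasing_def intro: canonical_tableau_less)

text \<open>Column 1 carries the partial sums, and all other entries lie strictly between two
  consecutive ones. The bound \<open>less\<close> excludes the total \<open>n\<close>, which is not
  in \<open>comp_set \<alpha>\<close>.\<close>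

lemma canonical_tableau_in_comp_set_iff:
  assumes \<alpha>: "\<alpha> \<in> compositions n" and c: "(i, j) \<in> diagram \<alpha>"
    and less: "canonical_tableau \<alpha> (i, j) < n"
  shows "canonical_tableau \<alpha> (i, j) \<in> comp_set \<alpha> \<longleftrightarrow> j = 1"
proof
  have i: "1 \<le> i" "i \<le> length \<alpha>" "1 \<le> j" using c by (auto simp: diagram_def)
  assume "canonical_tableau \<alpha> (i, j) \<in> comp_set \<alpha>"
  then obtain p where p: "canonical_tableau \<alpha> (i, j) = sum_list (take p \<alpha>)"
    by (auto simp: comp_set_def)
  show "j = 1"
  proof (rule ccontr)
    assume "j \<noteq> 1"
    then have "sum_list (take p \<alpha>) < sum_list (take i \<alpha>)"
      using canonical_tableau(1)[OF c] i p by linarith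
    then have "p \<le> i - 1" using sum_list_take_mono[of i p \<alpha>] by linarith
    then show False
      using sum_list_take_mono[of p "i - 1" \<alpha>] canonical_tableau(2)[OF c] p by linarith
  qed
next
  assume "j = 1"
  then have eq: "canonical_tableau \<alpha> (i, j) = sum_list (take i \<alpha>)"
    using canonical_tableau(1)[OF c] by simp
  have "i \<noteq> length \<alpha>" using less eq \<alpha> by (auto simp: compositions_def)
  then show "canonical_tableau \<alpha> (i, j) \<in> comp_set \<alpha>"
    using c eq by (auto simp: comp_set_def diagram_def)
qed

text \<open>If \<open>m\<close> is not in column 1, its left neighbour is \<open>m + 1\<close> and
  there is no descent; if it is, every cell is weakly right of it.\<close>

lemma Des_canonical_tableau:
  assumes \<alpha>: "\<alpha> \<in> compositions n"
  shows "Des \<alpha> (canonical_tableau \<alpha>) = comp_set \<alpha>"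
proof -
  have sum: "sum_list \<alpha> = n" using \<alpha> by (simp add: compositions_def)
  have surj: "\<exists>i j. (i, j) \<in> diagram \<alpha> \<and> canonical_tableau \<alpha> (i, j) = m" if "m \<in> {1..n}" for m
  proof -
    have "m \<in> canonical_tableau \<alpha> ` diagram \<alpha>"
      using bij_betw_imp_surj_on[OF bij_betw_canonical_tableau[of \<alpha>]] that sum by simp
    then show ?thesis by auto
  qed
  have "m \<in> Des \<alpha> (canonical_tableau \<alpha>) \<longleftrightarrow> m \<in> comp_set \<alpha>" if m: "m \<in> {1..<n}" for m
  proof -
    obtain i j where c: "(i, j) \<in> diagram \<alpha>" "canonical_tableau \<alpha> (i, j) = m"
      using surj[of m] m by auto
    obtain i' j' where d: "(i', j') \<in> diagram \<alpha>" "canonical_tableau \<alpha> (i', j') = m + 1"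
      using surj[of "m + 1"] m by auto
    have inj: "inj_on (canonical_tableau \<alpha>) (diagram \<alpha>)"
      using bij_betw_canonical_tableau bij_betw_imp_inj_on by blast
    have "m \<in> Des \<alpha> (canonical_tableau \<alpha>) \<longleftrightarrow> j \<le> j'"
    proof
      assume "m \<in> Des \<alpha> (canonical_tableau \<alpha>)"
      then obtain c' d' where "c' \<in> diagram \<alpha>" "d' \<in> diagram \<alpha>" "canonical_tableau \<alpha> c' = m"
        "canonical_tableau \<alpha> d' = m + 1" "snd c' \<le> snd d'" by (auto simp: Des_def)
      moreover from this have "c' = (i, j)" "d' = (i', j')"
        using inj_onD[OF inj] c d by auto
      ultimately show "j \<le> j'" by simp
    next
      assume "j \<le> j'"
      then show "m \<in> Des \<alpha> (canonical_tableau \<alpha>)"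
        using m c d sum unfolding Des_def by force
    qed
    moreover have "j \<le> j' \<longleftrightarrow> j = 1"
    proof
      assume "j \<le> j'"
      show "j = 1"
      proof (rule ccontr)
        assume "j \<noteq> 1"
        then obtain k where k: "j = Suc k" "1 \<le> k" using c by (cases j) (auto simp: diagram_def)
        then have "canonical_tableau \<alpha> (i, k) = m + 1" "(i, k) \<in> diagram \<alpha>"
          using canonical_tableau_step[of i k \<alpha>] c diagram_left[of i j \<alpha> k] by auto
        then have "(i, k) = (i', j')" using inj_onD[OF inj] d by metis
        with k \<open>j \<le> j'\<close> show False by simp
      qed
    qed (use d in \<open>auto simp: diagram_def\<close>)
    ultimately show ?thesis
      using canonical_tableau_in_comp_set_iff[OF \<alpha> c(1)] c m by simp
  qed
  moreover have "Des \<alpha> (canonical_tableau \<alpha>) \<subseteq> {1..<n}" using sum by (auto simp: Des_def)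
  ultimately show ?thesis using comp_set_subset[OF \<alpha>] by blast
qed

text \<open>The rows are runs of consecutive values with increasing heads, so rows up to
  \<open>i\<close> hold exactly the values up to \<open>\<tau> (i, 1)\<close>. The resulting count
  depends on the shape only, which allows two such fillings to be compared.\<close>

lemma contiguous_rows_first_column:
  assumes bij: "bij_betw \<tau> (diagram \<alpha>) {1..n}"
    and step: "\<And>i k. (i, Suc k) \<in> diagram \<alpha> \<Longrightarrow> 1 \<le> k \<Longrightarrow> \<tau> (i, k) = Suc (\<tau> (i, Suc k))"
    and first: "\<And>i i'. (i, 1) \<in> diagram \<alpha> \<Longrightarrow> (i', 1) \<in> diagram \<alpha> \<Longrightarrow> i < i' \<Longrightarrow> \<tau> (i, 1) < \<tau> (i', 1)"
    and i: "(i, 1) \<in> diagram \<alpha>"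
  shows "\<tau> (i, 1) = card {c \<in> diagram \<alpha>. fst c \<le> i}"
proof -
  have inj: "inj_on \<tau> (diagram \<alpha>)" and im: "\<tau> ` diagram \<alpha> = {1..n}"
    using bij by (auto simp: bij_betw_def)
  have le: "\<tau> (i', j) \<le> \<tau> (i', 1)" if "(i', j) \<in> diagram \<alpha>" for i' j
    using that
  proof (induction j)
    case (Suc k)
    show ?case
    proof (cases "k = 0")
      case False
      then show ?thesis
        using Suc step[of i' k] diagram_left[of i' "Suc k" \<alpha> k] by auto
    qed simp
  qed (simp add: diagram_def)
  have low: "\<tau> (i', j) \<le> \<tau> (i, 1)" if "(i', j) \<in> diagram \<alpha>" "i' \<le> i" for i' j
  proof -
    have "(i', 1) \<in> diagram \<alpha>" using diagram_left[OF that(1), of 1] that by (auto simp: diagram_def)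
    then have "\<tau> (i', 1) \<le> \<tau> (i, 1)" using first[of i' i] i that by (cases "i' = i") auto
    with le[OF that(1)] show ?thesis by simp
  qed
  \<comment> \<open>Along row \<open>i'\<close> the values start above \<open>\<tau> (i, 1)\<close>
    and drop by one at a time; injectivity keeps them from reaching it.\<close>
  have high: "\<tau> (i, 1) < \<tau> (i', j)" if "(i', j) \<in> diagram \<alpha>" "i < i'" for i' j
    using that
  proof (induction j)
    case (Suc k)
    show ?case
    proof (cases "k = 0")
      case True
      then show ?thesis using first[of i i'] i Suc.prems by simp
    next
      case False
      then have "\<tau> (i, 1) < \<tau> (i', k)"
        using Suc diagram_left[of i' "Suc k" \<alpha> k] by auto
      then have "\<tau> (i, 1) \<le> \<tau> (i', Suc k)" using step[of i' k] Suc.prems False by simp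
      moreover have "\<tau> (i, 1) \<noteq> \<tau> (i', Suc k)"
        using inj_onD[OF inj _ i Suc.prems(1)] Suc.prems(2) by auto
      ultimately show ?thesis by simp
    qed
  qed (simp add: diagram_def)
  have "\<tau> ` {c \<in> diagram \<alpha>. fst c \<le> i} = {1..\<tau> (i, 1)}"
  proof (intro equalityI subsetI)
    fix m assume m: "m \<in> {1..\<tau> (i, 1)}"
    moreover have "\<tau> (i, 1) \<le> n" using im i by fastforce
    ultimately have "m \<in> \<tau> ` diagram \<alpha>" unfolding im by simp
    then obtain i' j where "(i', j) \<in> diagram \<alpha>" "m = \<tau> (i', j)" by auto
    moreover from this have "i' \<le> i" using high[of i' j] m by (auto simp: not_less[symmetric])
    ultimately show "m \<in> \<tau> ` {c \<in> diagram \<alpha>. fst c \<le> i}" by force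
  qed (use low im in force)
  moreover have "inj_on \<tau> {c \<in> diagram \<alpha>. fst c \<le> i}" using inj by (rule inj_on_subset) auto
  ultimately have "card {1..\<tau> (i, 1)} = card {c \<in> diagram \<alpha>. fst c \<le> i}"
    by (metis card_image)
  then show ?thesis by simp
qed

text \<open>The shape fixes the first column, and \<open>step\<close> then fixes each row from left
  to right.\<close>

lemma contiguous_rows_unique:
  assumes srct: "\<tau> \<in> SRCT \<alpha>"
    and step: "\<And>i k. (i, Suc k) \<in> diagram \<alpha> \<Longrightarrow> 1 \<le> k \<Longrightarrow> \<tau> (i, k) = Suc (\<tau> (i, Suc k))"
  shows "\<tau> = canonical_tableau \<alpha>"
proof (rule extensionalityI[of _ "diagram \<alpha>"])
  show "\<tau> \<in> extensional (diagram \<alpha>)" "canonical_tableau \<alpha> \<in> extensional (diagram \<alpha>)"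
    using SRCT_extensional srct canonical_tableau_SRCT by blast+
  have first: "\<tau> (i, 1) = canonical_tableau \<alpha> (i, 1)" if "(i, 1) \<in> diagram \<alpha>" for i
  proof -
    have "\<tau> (i, 1) = card {c \<in> diagram \<alpha>. fst c \<le> i}"
      by (rule contiguous_rows_first_column[OF SRCT_bij_betw[OF srct] step
            SRCT_first_column[OF srct] that])
    also have "\<dots> = canonical_tableau \<alpha> (i, 1)"
      by (rule contiguous_rows_first_column[OF bij_betw_canonical_tableau canonical_tableau_step
            canonical_tableau_less that, symmetric])
    finally show ?thesis .
  qed
  have "\<tau> (i, j) = canonical_tableau \<alpha> (i, j)" if "(i, j) \<in> diagram \<alpha>" for i j
    using that
  proof (induction j)
    case (Suc k)
    show ?case
    proof (cases "k = 0")
      case True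
      then show ?thesis using first Suc.prems by simp
    next
      case False
      then show ?thesis
        using Suc step[of i k] canonical_tableau_step[of i k \<alpha>] diagram_left[of i "Suc k" \<alpha> k]
        by simp
    qed
  qed (simp add: diagram_def)
  then show "\<tau> c = canonical_tableau \<alpha> c" if "c \<in> diagram \<alpha>" for c
    using that by (cases c) auto
qed


subsection \<open>Triangularity\<close>

definition column_weight :: "nat list \<Rightarrow> nat" where
  "column_weight \<alpha> = (\<Sum>c\<in>diagram \<alpha>. snd c)"

text \<open>
  In the canonical tableau of shape \<open>\<beta>\<close> the column of a value is one more than its distance to the end of its
  block, so it serves as the lower bound on the column of that value in \<open>\<tau>\<close>.
\<close>

lemma canonical_tableau_column_le:
  assumes bij: "bij_betw \<tau> (diagram \<alpha>) {1..n}" and sum: "sum_list \<alpha> = n"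
    and \<beta>: "\<beta> \<in> compositions n" and des: "comp_set \<beta> = Des \<alpha> \<tau>"
    and "(i, j) \<in> diagram \<beta>" "c \<in> diagram \<alpha>" "\<tau> c = canonical_tableau \<beta> (i, j)"
  shows "j \<le> snd c"
  using assms(5-7)
proof (induction j arbitrary: c)
  case (Suc k)
  show ?case
  proof (cases "k = 0")
    case True
    then show ?thesis using Suc.prems by (auto simp: diagram_def)
  next
    case False
    let ?m = "canonical_tableau \<beta> (i, Suc k)"
    have k: "(i, k) \<in> diagram \<beta>" using Suc.prems(1) False diagram_left[of i "Suc k" \<beta> k] by simp
    have succ: "canonical_tableau \<beta> (i, k) = Suc ?m"
      using canonical_tableau_step[of i k \<beta>] Suc.prems(1) False by simp
    have "canonical_tableau \<beta> ` diagram \<beta> = {1..n}"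
      using bij_betw_imp_surj_on[OF bij_betw_canonical_tableau[of \<beta>]] \<beta>
      by (simp add: compositions_def)
    then have m: "1 \<le> ?m" "Suc ?m \<le> n"
      using imageI[OF Suc.prems(1), of "canonical_tableau \<beta>"]
        imageI[OF k, of "canonical_tableau \<beta>"] succ by auto
    then have "Suc ?m \<in> \<tau> ` diagram \<alpha>" using bij by (simp add: bij_betw_def)
    then obtain d where d: "d \<in> diagram \<alpha>" "\<tau> d = Suc ?m" by auto
    have "k \<le> snd d" using Suc.IH[OF k d(1)] d succ by simp
    \<comment> \<open>Outside column 1 of the \<beta> tableau, \<open>?m\<close> does not end a
      block. So it is no descent, and \<open>Suc ?m\<close> lies strictly left of \<open>?m\<close>
      in \<tau>.\<close>
    moreover have "?m \<notin> Des \<alpha> \<tau>"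
      using canonical_tableau_in_comp_set_iff[OF \<beta> Suc.prems(1)] m False des by auto
    then have "snd d < snd c"
      using m sum Suc.prems d unfolding Des_def by (auto simp: not_le)
    ultimately show ?thesis by simp
  qed
qed (simp add: diagram_def)

text \<open>This is the equality case of the weight bound. The successor of
  \<open>\<tau> (i, Suc k)\<close> is in column \<open>k\<close> of the \<beta> tableau, hence also
  of \<tau>; its row \<open>t\<close> must be shown to be \<open>i\<close>.\<close>

lemma column_preserving_imp_canonical_tableau:
  assumes srct: "\<tau> \<in> SRCT \<alpha>" and col: "column_increasing \<alpha> \<tau>" and sum: "sum_list \<alpha> = sum_list \<beta>"
    and eq: "\<And>c d. c \<in> diagram \<alpha> \<Longrightarrow> d \<in> diagram \<beta> \<Longrightarrow> \<tau> c = canonical_tableau \<beta> d \<Longrightarrow> snd c = snd d"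
  shows "\<tau> = canonical_tableau \<alpha>"
proof (rule contiguous_rows_unique[OF srct])
  fix i k assume c: "(i, Suc k) \<in> diagram \<alpha>" and k: "1 \<le> k"
  have im: "\<tau> ` diagram \<alpha> = canonical_tableau \<beta> ` diagram \<beta>"
    using SRCT_bij_betw[OF srct] bij_betw_canonical_tableau[of \<beta>] sum by (simp add: bij_betw_def)
  then obtain r j where "(r, j) \<in> diagram \<beta>" "\<tau> (i, Suc k) = canonical_tableau \<beta> (r, j)"
    using c by (metis (no_types, lifting) imageE imageI prod.collapse)
  with eq[OF c this] have r: "(r, Suc k) \<in> diagram \<beta>" "\<tau> (i, Suc k) = canonical_tableau \<beta> (r, Suc k)"
    by auto
  have r': "(r, k) \<in> diagram \<beta>" using diagram_left[OF r(1), of k] k by simp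
  moreover have succ: "canonical_tableau \<beta> (r, k) = Suc (\<tau> (i, Suc k))"
    using canonical_tableau_step[OF r(1) k] r by simp
  ultimately obtain t j' where "(t, j') \<in> diagram \<alpha>" "\<tau> (t, j') = canonical_tableau \<beta> (r, k)"
    using im by (metis (no_types, lifting) imageE imageI prod.collapse)
  with eq[OF this(1) r' this(2)] succ have t: "(t, k) \<in> diagram \<alpha>" "\<tau> (t, k) = Suc (\<tau> (i, Suc k))"
    by auto
  have ik: "(i, k) \<in> diagram \<alpha>" using diagram_left[OF c, of k] k by simp
  \<comment> \<open>A higher row \<open>t\<close> would, by the triple rule, have an entry in column
    \<open>k + 1\<close> exceeding the one in row \<open>i\<close>, against the increasing
    columns.\<close>
  have "\<not> t < i"
  proof
    assume "t < i"
    then have "(t, k + 1) \<in> diagram \<alpha> \<and> \<tau> (i, k + 1) < \<tau> (t, k + 1)"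
      using SRCT_triple[OF srct, of t i k] t c by simp
    moreover from this have "\<tau> (t, k + 1) < \<tau> (i, k + 1)"
      using col \<open>t < i\<close> c unfolding column_increasing_def Suc_eq_plus1 by blast
    ultimately show False by simp
  qed
  \<comment> \<open>A lower row \<open>t\<close> would place \<open>\<tau> (i, k)\<close> strictly
    between \<open>\<tau> (i, Suc k)\<close> and its successor.\<close>
  moreover have "\<not> i < t"
  proof
    assume "i < t"
    then have "\<tau> (i, k) < \<tau> (t, k)" using col ik t unfolding column_increasing_def by blast
    moreover have "\<tau> (i, Suc k) < \<tau> (i, k)" using SRCT_row[OF srct ik c] by simp
    ultimately show False using t by simp
  qed
  ultimately show "\<tau> (i, k) = Suc (\<tau> (i, Suc k))" using t by (cases "t = i") auto
qed

lemma column_weight_less: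
  assumes \<alpha>: "\<alpha> \<in> compositions n" and \<beta>: "\<beta> \<in> compositions n"
    and srct: "\<tau> \<in> SRCT \<alpha>" and col: "column_increasing \<alpha> \<tau>" and des: "comp_set \<beta> = Des \<alpha> \<tau>"
    and neq: "\<tau> \<noteq> canonical_tableau \<alpha>"
  shows "column_weight \<beta> < column_weight \<alpha>"
proof -
  have sum: "sum_list \<alpha> = n" "sum_list \<beta> = n" using \<alpha> \<beta> by (auto simp: compositions_def)
  have bij: "bij_betw \<tau> (diagram \<alpha>) {1..n}" using SRCT_bij_betw[OF srct] sum by simp
  have bij\<beta>: "bij_betw (canonical_tableau \<beta>) (diagram \<beta>) {1..n}"
    using bij_betw_canonical_tableau[of \<beta>] sum by simp
  \<comment> \<open>\<open>h\<close> matches cells carrying the same value in \<tau> and in the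
    canonical tableau of \<beta>, so the two weights can be compared cell by cell.\<close>
  define h where "h = inv_into (diagram \<beta>) (canonical_tableau \<beta>) \<circ> \<tau>"
  have h: "bij_betw h (diagram \<alpha>) (diagram \<beta>)"
    unfolding h_def by (rule bij_betw_trans[OF bij bij_betw_inv_into[OF bij\<beta>]])
  have h_in: "h c \<in> diagram \<beta>" if "c \<in> diagram \<alpha>" for c
    using h that by (auto simp: bij_betw_def)
  have h_eq: "canonical_tableau \<beta> (h c) = \<tau> c" if "c \<in> diagram \<alpha>" for c
    unfolding h_def using bij_betw_inv_into_right[OF bij\<beta>] bij_betwE[OF bij] that by simp
  have weight: "column_weight \<beta> = (\<Sum>c\<in>diagram \<alpha>. snd (h c))"
    unfolding column_weight_def by (rule sum.reindex_bij_betw[OF h, symmetric])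
  have le: "snd (h c) \<le> snd c" if "c \<in> diagram \<alpha>" for c
    using canonical_tableau_column_le[OF bij sum(1) \<beta> des, of "fst (h c)" "snd (h c)" c]
      h_in h_eq that by simp
  have "\<exists>c\<in>diagram \<alpha>. snd (h c) < snd c"
  proof (rule ccontr)
    assume "\<not> ?thesis"
    then have eq: "snd (h c) = snd c" if "c \<in> diagram \<alpha>" for c
      using le that by (meson le_neq_implies_less)
    have "\<tau> = canonical_tableau \<alpha>"
    proof (rule column_preserving_imp_canonical_tableau[OF srct col, of \<beta>])
      fix c d assume "c \<in> diagram \<alpha>" "d \<in> diagram \<beta>" "\<tau> c = canonical_tableau \<beta> d"
      moreover from this have "h c = d"
        using h_in h_eq bij_betw_imp_inj_on[OF bij\<beta>] by (metis inj_onD)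
      ultimately show "snd c = snd d" using eq by metis
    qed (simp add: sum)
    with neq show False by blast
  qed
  with le show ?thesis
    unfolding weight column_weight_def[of \<alpha>]
    by (intro sum_strict_mono_ex1[OF finite_diagram]) auto
qed

section \<open>Expansion of the canonical functions and the basis theorem\<close>

lemma finite_SRCT: "finite (SRCT \<alpha>)"
proof (rule finite_subset)
  show "SRCT \<alpha> \<subseteq> diagram \<alpha> \<rightarrow>\<^sub>E {1..sum_list \<alpha>}"
  proof
    fix \<tau> assume "\<tau> \<in> SRCT \<alpha>"
    then show "\<tau> \<in> diagram \<alpha> \<rightarrow>\<^sub>E {1..sum_list \<alpha>}"
      using SRCT_extensional bij_betwE[OF SRCT_bij_betw] unfolding PiE_iff by blast
  qed
qed (intro finite_PiE finite_diagram finite_atLeastAtMost)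

lemma Des_subset: "Des \<alpha> \<tau> \<subseteq> {1..<sum_list \<alpha>}"
  by (auto simp: Des_def)

lemma fundamental_comp_tab:
  assumes "sum_list \<beta> = sum_list \<alpha>" "comp_set \<beta> = Des \<alpha> \<tau>"
  shows "fundamental (comp_tab \<alpha> \<tau>) = fundamental \<beta>"
  unfolding comp_tab_def
  using comp_of_set[OF Des_subset[of \<alpha> \<tau>]] assms by (intro fundamental_cong) simp_all

text \<open>The canonical tableau contributes the fundamental function of \<alpha> itself; every
  other tableau contributes one of strictly smaller weight.\<close>

lemma canonical_unitriangular:
  assumes \<alpha>: "\<alpha> \<in> compositions n"
  shows "canonical \<alpha> - fundamental \<alpha> \<in>
    series.span (fundamental ` {\<beta> \<in> compositions n. column_weight \<beta> < column_weight \<alpha>})"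
proof -
  let ?T = "{\<tau> \<in> SRCT \<alpha>. column_increasing \<alpha> \<tau>}"
  have sum: "sum_list \<alpha> = n" using \<alpha> by (simp add: compositions_def)
  have "finite ?T" "canonical_tableau \<alpha> \<in> ?T"
    using finite_SRCT canonical_tableau_SRCT column_increasing_canonical_tableau by auto
  then have "canonical \<alpha> = fundamental (comp_tab \<alpha> (canonical_tableau \<alpha>)) +
      (\<Sum>\<tau>\<in>?T - {canonical_tableau \<alpha>}. fundamental (comp_tab \<alpha> \<tau>))"
    unfolding canonical_def by (rule sum.remove)
  moreover have "fundamental (comp_tab \<alpha> (canonical_tableau \<alpha>)) = fundamental \<alpha>"
    using Des_canonical_tableau[OF \<alpha>] by (intro fundamental_comp_tab) auto
  ultimately have "canonical \<alpha> - fundamental \<alpha> =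
      (\<Sum>\<tau>\<in>?T - {canonical_tableau \<alpha>}. fundamental (comp_tab \<alpha> \<tau>))" by simp
  also have "\<dots> \<in> series.span (fundamental ` {\<beta> \<in> compositions n. column_weight \<beta> < column_weight \<alpha>})"
  proof (intro series.span_sum series.span_base)
    fix \<tau> assume \<tau>: "\<tau> \<in> ?T - {canonical_tableau \<alpha>}"
    obtain \<beta> where \<beta>: "\<beta> \<in> compositions n" "comp_set \<beta> = Des \<alpha> \<tau>"
      using comp_set_surj[OF Des_subset[of \<alpha> \<tau>]] sum by auto
    then have "fundamental (comp_tab \<alpha> \<tau>) = fundamental \<beta>"
      using sum by (intro fundamental_comp_tab) (auto simp: compositions_def)
    moreover have "column_weight \<beta> < column_weight \<alpha>"
      using column_weight_less[OF \<alpha> \<beta>(1) _ _ \<beta>(2)] \<tau> by auto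
    ultimately show "fundamental (comp_tab \<alpha> \<tau>) \<in>
        fundamental ` {\<beta> \<in> compositions n. column_weight \<beta> < column_weight \<alpha>}"
      using \<beta> by auto
  qed
  finally show ?thesis .
qed

theorem proposition8p2:
  fixes n :: nat
  shows "inj_on canonical (compositions n) \<and>
    series.independent (canonical ` compositions n) \<and>
    series.span (canonical ` compositions n) = QSym n"
  unfolding QSym_def
  using series.unitriangular_basis[OF finite_compositions fundamental_independent
      canonical_unitriangular] by blast

end
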